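(* The binary tree space $X=X_T$ has the alternative Daugavet property. In particular, it has numerical index 1.
   Context: Binary tree space: $T=\{\emptyset\}\cup\bigcup_{n\in\mathbb{N}}\{0,1\}^n$ is the infinite binary tree of finite $0$-$1$ sequences, ordered by $s\preceq t$ iff $s$ is an initial segment of $t$. A chain is a non-empty (totally, hence well) ordered subset of $T$; $\mathcal{A}$ is the collection of all chains. $X=X_T$ is the real Banach space obtained by completing the space $c_{00}(T)$ of finitely supported real functions on $T$ for the norm $\|x\|=\sup_{A\in\mathcal{A}}\sum_{t\in A}|x(t)|$. A real Banach space $X$ has the alternative Daugavet property if every rank 1 bounded operator $R\colon X\to X$ satisfies $\max_{\theta\in\{-1,1\}}\|\mathrm{Id}+\theta R\|=1+\|R\|$. $X$ has numerical index 1 if every bounded linear operator $R\colon X\to X$ satisfies $\|R\|=\sup\{|f(Rx)|\colon x\in S_X,\ f\in S_{X^*},\ f(x)=1\}$, where $S_X$, $S_{X^*}$ are the unit spheres. *)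

theory Defs
  imports "HOL-Analysis.Analysis" "HOL-Library.Sublist"
begin

section \<open>Chains of the binary tree\<close>

text \<open>The nodes of the infinite binary tree are the finite 0-1 sequences, i.e. all values of type
  \<^typ>\<open>bool list\<close>, ordered by \<^const>\<open>prefix\<close>. Chains may be infinite.\<close>

definition tree_chains :: "bool list set set" where
  "tree_chains = {A. A \<noteq> {} \<and> (\<forall>s\<in>A. \<forall>t\<in>A. prefix s t \<or> prefix t s)}"

lemma singleton_tree_chain: "{t} \<in> tree_chains"
  by (simp add: tree_chains_def)

section \<open>The normed space of finitely supported functions on the tree\<close>

typedef c00_tree = "{x :: bool list \<Rightarrow> real. finite {t. x t \<noteq> 0}}"
  morphisms tree_coeff Abs_c00_tree
  by (rule exI[of _ "\<lambda>_. 0"]) simp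

setup_lifting type_definition_c00_tree

lemma finite_support_tree_coeff: "finite {t. tree_coeff x t \<noteq> 0}"
  using tree_coeff[of x] by simp

instantiation c00_tree :: real_vector
begin

lift_definition zero_c00_tree :: c00_tree is "\<lambda>_. 0" by simp

lift_definition plus_c00_tree :: "c00_tree \<Rightarrow> c00_tree \<Rightarrow> c00_tree" is "\<lambda>x y t. x t + y t"
proof -
  fix x y :: "bool list \<Rightarrow> real"
  assume "finite {t. x t \<noteq> 0}" "finite {t. y t \<noteq> 0}"
  then show "finite {t. x t + y t \<noteq> 0}"
    by - (rule finite_subset[of _ "{t. x t \<noteq> 0} \<union> {t. y t \<noteq> 0}"], auto)
qed

lift_definition minus_c00_tree :: "c00_tree \<Rightarrow> c00_tree \<Rightarrow> c00_tree" is "\<lambda>x y t. x t - y t"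
proof -
  fix x y :: "bool list \<Rightarrow> real"
  assume "finite {t. x t \<noteq> 0}" "finite {t. y t \<noteq> 0}"
  then show "finite {t. x t - y t \<noteq> 0}"
    by - (rule finite_subset[of _ "{t. x t \<noteq> 0} \<union> {t. y t \<noteq> 0}"], auto)
qed

lift_definition uminus_c00_tree :: "c00_tree \<Rightarrow> c00_tree" is "\<lambda>x t. - x t" by simp

lift_definition scaleR_c00_tree :: "real \<Rightarrow> c00_tree \<Rightarrow> c00_tree" is "\<lambda>r x t. r * x t"
  by (rule finite_subset) auto

instance
  by standard (transfer; simp add: fun_eq_iff algebra_simps)+

end

text \<open>For \<^typ>\<open>c00_tree\<close> every one of these sums has only finitely many nonzero terms.\<close>

definition chain_sum :: "bool list set \<Rightarrow> c00_tree \<Rightarrow> real" where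
  "chain_sum A x = (\<Sum>\<^sub>\<infinity>t\<in>A. \<bar>tree_coeff x t\<bar>)"

lemma chain_sum_finite:
  assumes "finite F" "{t. tree_coeff x t \<noteq> 0} \<subseteq> F"
  shows "chain_sum A x = (\<Sum>t\<in>A \<inter> F. \<bar>tree_coeff x t\<bar>)"
proof -
  have "chain_sum A x = (\<Sum>\<^sub>\<infinity>t\<in>A \<inter> F. \<bar>tree_coeff x t\<bar>)"
    unfolding chain_sum_def by (rule infsum_cong_neutral) (use assms in auto)
  then show ?thesis using assms by (simp add: infsum_finite)
qed

lemma chain_sum_bdd_above: "bdd_above ((\<lambda>A. chain_sum A x) ` S)"
proof (rule bdd_aboveI2)
  fix A
  show "chain_sum A x \<le> (\<Sum>t | tree_coeff x t \<noteq> 0. \<bar>tree_coeff x t\<bar>)"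
    by (subst chain_sum_finite[OF finite_support_tree_coeff order_refl])
      (rule sum_mono2, auto simp: finite_support_tree_coeff)
qed

lemma chain_sum_triangle: "chain_sum A (x + y) \<le> chain_sum A x + chain_sum A y"
proof -
  let ?F = "{t. tree_coeff x t \<noteq> 0} \<union> {t. tree_coeff y t \<noteq> 0}"
  have F: "finite ?F" by (simp add: finite_support_tree_coeff)
  have 1: "{t. tree_coeff (x + y) t \<noteq> 0} \<subseteq> ?F" by (auto simp: plus_c00_tree.rep_eq)
  have "chain_sum A (x + y) \<le> (\<Sum>t\<in>A \<inter> ?F. \<bar>tree_coeff x t\<bar> + \<bar>tree_coeff y t\<bar>)"
    unfolding chain_sum_finite[OF F 1] by (rule sum_mono) (simp add: plus_c00_tree.rep_eq)
  also have "\<dots> = chain_sum A x + chain_sum A y"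
    by (subst (1 2) chain_sum_finite[OF F]) (auto simp: sum.distrib)
  finally show ?thesis .
qed

lemma chain_sum_scaleR: "chain_sum A (r *\<^sub>R x) = \<bar>r\<bar> * chain_sum A x"
  by (simp add: chain_sum_def scaleR_c00_tree.rep_eq abs_mult infsum_cmult_right')

lemma chain_sum_nonneg: "0 \<le> chain_sum A x"
  by (simp add: chain_sum_def infsum_nonneg)

instantiation c00_tree :: real_normed_vector
begin

definition norm_c00_tree :: "c00_tree \<Rightarrow> real" where
  "norm_c00_tree x = (SUP A\<in>tree_chains. chain_sum A x)"

definition dist_c00_tree :: "c00_tree \<Rightarrow> c00_tree \<Rightarrow> real" where
  "dist_c00_tree x y = norm (x - y)"

definition sgn_c00_tree :: "c00_tree \<Rightarrow> c00_tree" where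
  "sgn_c00_tree x = inverse (norm x) *\<^sub>R x"

definition uniformity_c00_tree :: "(c00_tree \<times> c00_tree) filter" where
  "uniformity_c00_tree = (INF e\<in>{0<..}. principal {(x, y). dist x y < e})"

definition open_c00_tree :: "c00_tree set \<Rightarrow> bool" where
  "open_c00_tree U = (\<forall>x\<in>U. \<forall>\<^sub>F (x', y) in uniformity. x' = x \<longrightarrow> y \<in> U)"

instance
proof
  fix x y :: c00_tree and r :: real
  have ne: "tree_chains \<noteq> {}" using singleton_tree_chain by blast
  have upper: "chain_sum A z \<le> norm z" if "A \<in> tree_chains" for A z
    unfolding norm_c00_tree_def by (rule cSUP_upper[OF that chain_sum_bdd_above])
  have scale: "norm (s *\<^sub>R z) \<le> \<bar>s\<bar> * norm z" for s and z :: c00_tree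
    unfolding norm_c00_tree_def[of "s *\<^sub>R z"] chain_sum_scaleR
    by (rule cSUP_least[OF ne]) (intro mult_left_mono upper, auto)
  show "norm (x + y) \<le> norm x + norm y"
    unfolding norm_c00_tree_def[of "x + y"]
    by (rule cSUP_least[OF ne], rule order_trans[OF chain_sum_triangle add_mono[OF upper upper]])
  show "norm (r *\<^sub>R x) = \<bar>r\<bar> * norm x"
  proof (cases "r = 0")
    case True
    have "0 \<le> norm (r *\<^sub>R x)"
      by (rule order_trans[OF chain_sum_nonneg upper[OF singleton_tree_chain[of "[]"]]])
    with True scale[of r x] show ?thesis by simp
  next
    case False
    have "norm x \<le> \<bar>inverse r\<bar> * norm (r *\<^sub>R x)"
      using scale[of "inverse r" "r *\<^sub>R x"] False by simp
    then have "\<bar>r\<bar> * norm x \<le> norm (r *\<^sub>R x)"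
      using False by (simp add: field_simps)
    with scale[of r x] show ?thesis by simp
  qed
  show "norm x = 0 \<longleftrightarrow> x = 0"
  proof
    assume 0: "norm x = 0"
    have "tree_coeff x t = 0" for t
      using upper[OF singleton_tree_chain[of t], of x] 0 by (simp add: chain_sum_def)
    then show "x = 0"
      by (simp add: tree_coeff_inject[symmetric] zero_c00_tree.rep_eq fun_eq_iff)
  next
    assume "x = 0"
    then show "norm x = 0"
      using ne by (simp add: norm_c00_tree_def chain_sum_def zero_c00_tree.rep_eq)
  qed
qed (simp_all add: dist_c00_tree_def sgn_c00_tree_def uniformity_c00_tree_def open_c00_tree_def)

end

section \<open>Completion of a normed space\<close>

text \<open>Equivalence classes of Cauchy sequences, modulo sequences converging to zero.\<close>

definition cauchy_rel :: "(nat \<Rightarrow> 'a::real_normed_vector) \<Rightarrow> (nat \<Rightarrow> 'a) \<Rightarrow> bool" where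
  "cauchy_rel X Y \<longleftrightarrow> Cauchy X \<and> Cauchy Y \<and> (\<lambda>n. X n - Y n) \<longlonglongrightarrow> 0"

lemma cauchy_relE:
  assumes "cauchy_rel X Y"
  obtains "Cauchy X" "Cauchy Y" "(\<lambda>n. X n - Y n) \<longlonglongrightarrow> 0"
  using assms by (auto simp: cauchy_rel_def)

lemma part_equivp_cauchy_rel: "part_equivp cauchy_rel"
proof (rule part_equivpI)
  show "\<exists>X. cauchy_rel X (X :: nat \<Rightarrow> 'a)"
    by (rule exI[of _ "\<lambda>_. 0"]) (simp add: cauchy_rel_def convergent_Cauchy convergent_const)
  show "symp (cauchy_rel :: (nat \<Rightarrow> 'a) \<Rightarrow> _)"
    by (rule sympI) (auto simp: cauchy_rel_def intro: Lim_transform dest: tendsto_minus)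
  show "transp (cauchy_rel :: (nat \<Rightarrow> 'a) \<Rightarrow> _)"
  proof (rule transpI)
    fix X Y Z :: "nat \<Rightarrow> 'a"
    assume "cauchy_rel X Y" "cauchy_rel Y Z"
    then show "cauchy_rel X Z"
      using tendsto_add[of "\<lambda>n. X n - Y n" 0 sequentially "\<lambda>n. Y n - Z n" 0]
      by (simp add: cauchy_rel_def)
  qed
qed

quotient_type (overloaded) 'a completion =
  "nat \<Rightarrow> 'a::real_normed_vector" / partial: cauchy_rel
  by (rule part_equivp_cauchy_rel)

lemma Cauchy_norm_sequence:
  fixes X :: "nat \<Rightarrow> 'a::real_normed_vector"
  assumes "Cauchy X"
  shows "Cauchy (\<lambda>n. norm (X n))"
proof (rule CauchyI)
  fix e :: real
  assume "0 < e"
  with assms obtain M where "\<forall>m\<ge>M. \<forall>n\<ge>M. norm (X m - X n) < e"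
    by (auto dest: CauchyD)
  then show "\<exists>M. \<forall>m\<ge>M. \<forall>n\<ge>M. norm (norm (X m) - norm (X n)) < e"
    by (metis norm_triangle_ineq3 order_le_less_trans real_norm_def)
qed

lemma tendsto_lim_norm:
  fixes X :: "nat \<Rightarrow> 'a::real_normed_vector"
  assumes "Cauchy X"
  shows "(\<lambda>n. norm (X n)) \<longlonglongrightarrow> lim (\<lambda>n. norm (X n))"
  using Cauchy_norm_sequence[OF assms] Cauchy_convergent convergent_LIMSEQ_iff by blast

lemma Cauchy_scaleR_sequence:
  fixes X :: "nat \<Rightarrow> 'a::real_normed_vector"
  assumes "Cauchy X"
  shows "Cauchy (\<lambda>n. r *\<^sub>R X n)"
  using bounded_linear.Cauchy[OF bounded_linear_scaleR_right assms] .

lemma Cauchy_plus_sequence: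
  fixes X Y :: "nat \<Rightarrow> 'a::real_normed_vector"
  assumes "Cauchy X" "Cauchy Y"
  shows "Cauchy (\<lambda>n. X n + Y n)"
proof (rule CauchyI)
  fix e :: real
  assume "0 < e"
  then have "0 < e / 2" by simp
  obtain M where M: "\<forall>m\<ge>M. \<forall>n\<ge>M. norm (X m - X n) < e / 2"
    using CauchyD[OF assms(1) \<open>0 < e / 2\<close>] by auto
  obtain N where N: "\<forall>m\<ge>N. \<forall>n\<ge>N. norm (Y m - Y n) < e / 2"
    using CauchyD[OF assms(2) \<open>0 < e / 2\<close>] by auto
  have "norm (X m + Y m - (X n + Y n)) < e" if "m \<ge> max M N" "n \<ge> max M N" for m n
  proof -
    have "norm (X m + Y m - (X n + Y n)) \<le> norm (X m - X n) + norm (Y m - Y n)"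
      by (simp add: add_diff_add norm_triangle_ineq)
    also have "\<dots> < e / 2 + e / 2" using M N that by (intro add_strict_mono) auto
    finally show ?thesis by simp
  qed
  then show "\<exists>M. \<forall>m\<ge>M. \<forall>n\<ge>M. norm (X m + Y m - (X n + Y n)) < e" by blast
qed

lemma Cauchy_uminus_sequence:
  fixes X :: "nat \<Rightarrow> 'a::real_normed_vector"
  shows "Cauchy X \<Longrightarrow> Cauchy (\<lambda>n. - X n)"
  using Cauchy_scaleR_sequence[of X "-1"] by simp

lemma Cauchy_minus_sequence:
  fixes X Y :: "nat \<Rightarrow> 'a::real_normed_vector"
  shows "Cauchy X \<Longrightarrow> Cauchy Y \<Longrightarrow> Cauchy (\<lambda>n. X n - Y n)"
  using Cauchy_plus_sequence[OF _ Cauchy_uminus_sequence, of X Y] by simp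

lemma Cauchy_const_sequence: "Cauchy (\<lambda>_. c :: 'a::real_normed_vector)"
  by (simp add: convergent_Cauchy convergent_const)

instantiation completion :: (real_normed_vector) real_normed_vector
begin

lift_definition zero_completion :: "'a completion" is "\<lambda>_. 0"
  by (simp add: cauchy_rel_def Cauchy_const_sequence)

lift_definition plus_completion :: "'a completion \<Rightarrow> 'a completion \<Rightarrow> 'a completion"
  is "\<lambda>X Y n. X n + Y n"
proof -
  fix X X' Y Y' :: "nat \<Rightarrow> 'a"
  assume "cauchy_rel X X'" "cauchy_rel Y Y'"
  then show "cauchy_rel (\<lambda>n. X n + Y n) (\<lambda>n. X' n + Y' n)"
    using tendsto_add[of "\<lambda>n. X n - X' n" 0 sequentially "\<lambda>n. Y n - Y' n" 0]
    by (simp add: cauchy_rel_def Cauchy_plus_sequence add_diff_add)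
qed

lift_definition uminus_completion :: "'a completion \<Rightarrow> 'a completion" is "\<lambda>X n. - X n"
proof -
  fix X Y :: "nat \<Rightarrow> 'a"
  assume "cauchy_rel X Y"
  then show "cauchy_rel (\<lambda>n. - X n) (\<lambda>n. - Y n)"
    using tendsto_minus[of "\<lambda>n. X n - Y n" 0 sequentially]
    by (simp add: cauchy_rel_def Cauchy_uminus_sequence)
qed

definition minus_completion :: "'a completion \<Rightarrow> 'a completion \<Rightarrow> 'a completion" where
  "minus_completion x y = x + - y"

lift_definition scaleR_completion :: "real \<Rightarrow> 'a completion \<Rightarrow> 'a completion"
  is "\<lambda>r X n. r *\<^sub>R X n"
proof -
  fix r :: real and X Y :: "nat \<Rightarrow> 'a"
  assume "cauchy_rel X Y"
  then show "cauchy_rel (\<lambda>n. r *\<^sub>R X n) (\<lambda>n. r *\<^sub>R Y n)"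
    using tendsto_scaleR[OF tendsto_const[of r], of "\<lambda>n. X n - Y n" 0 sequentially]
    by (simp add: cauchy_rel_def Cauchy_scaleR_sequence scaleR_diff_right)
qed

lift_definition norm_completion :: "'a completion \<Rightarrow> real" is "\<lambda>X. lim (\<lambda>n. norm (X n))"
proof -
  fix X Y :: "nat \<Rightarrow> 'a"
  assume XY: "cauchy_rel X Y"
  have "(\<lambda>n. norm (X n) - norm (Y n)) \<longlonglongrightarrow> 0"
    by (rule Lim_null_comparison[of _ "\<lambda>n. norm (X n - Y n)"])
      (use XY in \<open>auto simp: cauchy_rel_def norm_triangle_ineq3 tendsto_norm_zero_iff\<close>)
  moreover have "(\<lambda>n. norm (X n) - norm (Y n)) \<longlonglongrightarrow>
      lim (\<lambda>n. norm (X n)) - lim (\<lambda>n. norm (Y n))"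
    using XY by (intro tendsto_diff tendsto_lim_norm) (auto simp: cauchy_rel_def)
  ultimately show "lim (\<lambda>n. norm (X n)) = lim (\<lambda>n. norm (Y n))"
    using LIMSEQ_unique by fastforce
qed

definition dist_completion :: "'a completion \<Rightarrow> 'a completion \<Rightarrow> real" where
  "dist_completion x y = norm (x - y)"

definition sgn_completion :: "'a completion \<Rightarrow> 'a completion" where
  "sgn_completion x = inverse (norm x) *\<^sub>R x"

definition uniformity_completion :: "('a completion \<times> 'a completion) filter" where
  "uniformity_completion = (INF e\<in>{0<..}. principal {(x, y). dist x y < e})"

definition open_completion :: "'a completion set \<Rightarrow> bool" where
  "open_completion U = (\<forall>x\<in>U. \<forall>\<^sub>F (x', y) in uniformity. x' = x \<longrightarrow> y \<in> U)"

instance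
proof
  fix x y z :: "'a completion" and r s :: real
  show "x + y + z = x + (y + z)"
    by transfer (auto simp: cauchy_rel_def Cauchy_plus_sequence add.assoc)
  show "x + y = y + x"
    by transfer (auto simp: cauchy_rel_def Cauchy_plus_sequence add.commute)
  show "0 + x = x"
    by transfer (auto simp: cauchy_rel_def)
  show "- x + x = 0"
    by transfer (auto simp: cauchy_rel_def Cauchy_const_sequence)
  show "x - y = x + - y"
    by (rule minus_completion_def)
  show "r *\<^sub>R (x + y) = r *\<^sub>R x + r *\<^sub>R y"
    by transfer
      (auto simp: cauchy_rel_def Cauchy_plus_sequence Cauchy_scaleR_sequence scaleR_add_right)
  show "(r + s) *\<^sub>R x = r *\<^sub>R x + s *\<^sub>R x"
    by transfer
      (auto simp: cauchy_rel_def Cauchy_plus_sequence Cauchy_scaleR_sequence scaleR_add_left)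
  show "r *\<^sub>R s *\<^sub>R x = (r * s) *\<^sub>R x"
    by transfer (auto simp: cauchy_rel_def Cauchy_scaleR_sequence)
  show "1 *\<^sub>R x = x"
    by transfer (auto simp: cauchy_rel_def)
  show "norm x = 0 \<longleftrightarrow> x = 0"
  proof transfer
    fix X :: "nat \<Rightarrow> 'a"
    assume "cauchy_rel X X"
    then have X: "Cauchy X" by (simp add: cauchy_rel_def)
    have "lim (\<lambda>n. norm (X n)) = 0 \<longleftrightarrow> (\<lambda>n. norm (X n)) \<longlonglongrightarrow> 0"
      using tendsto_lim_norm[OF X] limI by metis
    then show "lim (\<lambda>n. norm (X n)) = 0 \<longleftrightarrow> cauchy_rel X (\<lambda>_. 0)"
      by (simp add: cauchy_rel_def X Cauchy_const_sequence tendsto_norm_zero_iff)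
  qed
  show "norm (x + y) \<le> norm x + norm y"
  proof transfer
    fix X Y :: "nat \<Rightarrow> 'a"
    assume "cauchy_rel X X" "cauchy_rel Y Y"
    then have X: "Cauchy X" and Y: "Cauchy Y" by (simp_all add: cauchy_rel_def)
    show "lim (\<lambda>n. norm (X n + Y n)) \<le> lim (\<lambda>n. norm (X n)) + lim (\<lambda>n. norm (Y n))"
      by (rule LIMSEQ_le[OF tendsto_lim_norm[OF Cauchy_plus_sequence[OF X Y]]
            tendsto_add[OF tendsto_lim_norm[OF X] tendsto_lim_norm[OF Y]]])
        (auto intro: norm_triangle_ineq)
  qed
  show "norm (r *\<^sub>R x) = \<bar>r\<bar> * norm x"
  proof transfer
    fix r :: real and X :: "nat \<Rightarrow> 'a"
    assume "cauchy_rel X X"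
    then have X: "Cauchy X" by (simp add: cauchy_rel_def)
    show "lim (\<lambda>n. norm (r *\<^sub>R X n)) = \<bar>r\<bar> * lim (\<lambda>n. norm (X n))"
      by (rule limI) (simp add: tendsto_mult_left tendsto_lim_norm[OF X])
  qed
qed (simp_all add: dist_completion_def sgn_completion_def uniformity_completion_def
      open_completion_def)

end

lift_definition to_completion :: "'a::real_normed_vector \<Rightarrow> 'a completion" is "\<lambda>a _. a"
  by (simp add: cauchy_rel_def Cauchy_const_sequence)

lemma linear_to_completion: "linear to_completion"
  by (rule linearI; transfer) (simp_all add: cauchy_rel_def Cauchy_const_sequence)

lemma norm_to_completion: "norm (to_completion a) = norm a"
  by transfer (simp add: limI)

lemma dist_to_completion: "dist (to_completion a) (to_completion b) = dist a b"
  by (metis dist_norm linear_diff linear_to_completion norm_to_completion)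

lemma Cauchy_tendsto_completion:
  fixes a :: "nat \<Rightarrow> 'a::real_normed_vector"
  assumes a: "Cauchy a"
  shows "(\<lambda>n. to_completion (a n)) \<longlonglongrightarrow> abs_completion a"
proof (rule metric_LIMSEQ_I)
  fix e :: real
  assume "0 < e"
  then obtain M where M: "\<And>m n. m \<ge> M \<Longrightarrow> n \<ge> M \<Longrightarrow> norm (a m - a n) < e / 2"
    using CauchyD[OF a, of "e / 2"] by auto
  have "dist (to_completion (a n)) (abs_completion a) < e" if "n \<ge> M" for n
  proof -
    have C: "Cauchy (\<lambda>k. a n - a k)"
      using a by (intro Cauchy_minus_sequence Cauchy_const_sequence)
    have r: "cauchy_rel (\<lambda>_. a n) (\<lambda>_. a n)" "cauchy_rel a a"
        "cauchy_rel (\<lambda>k. - a k) (\<lambda>k. - a k)"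
        "cauchy_rel (\<lambda>k. a n - a k) (\<lambda>k. a n - a k)"
      using a C by (simp_all add: cauchy_rel_def Cauchy_const_sequence Cauchy_uminus_sequence)
    have "to_completion (a n) - abs_completion a = abs_completion (\<lambda>k. a n - a k)"
      by (simp add: minus_completion_def to_completion.abs_eq uminus_completion.abs_eq
          plus_completion.abs_eq r)
    then have "dist (to_completion (a n)) (abs_completion a) = lim (\<lambda>k. norm (a n - a k))"
      by (simp add: dist_norm norm_completion.abs_eq r)
    also have "\<dots> \<le> e / 2"
      by (rule LIMSEQ_le_const2[OF tendsto_lim_norm[OF C]]) (meson M less_imp_le that)
    finally show ?thesis using \<open>0 < e\<close> by simp
  qed
  then show "\<exists>M. \<forall>n\<ge>M. dist (to_completion (a n)) (abs_completion a) < e" by blast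
qed

lemma to_completion_approx:
  fixes x :: "'a::real_normed_vector completion"
  assumes "0 < e"
  shows "\<exists>a. dist (to_completion a) x < e"
proof -
  obtain a where a: "Cauchy a" "x = abs_completion a"
    by (induct x) (auto simp: cauchy_rel_def)
  show ?thesis
    using metric_LIMSEQ_D[OF Cauchy_tendsto_completion[OF a(1)] assms] a(2) by blast
qed

lemma closure_range_to_completion: "closure (range to_completion) = UNIV"
  using to_completion_approx by (auto simp: closure_approachable)

instance completion :: (real_normed_vector) banach
proof
  fix X :: "nat \<Rightarrow> 'a completion"
  assume X: "Cauchy X"
  have "\<exists>a. dist (to_completion a) (X n) < inverse (real (Suc n))" for n
    by (rule to_completion_approx) simp
  then obtain a where a: "\<And>n. dist (to_completion (a n)) (X n) < inverse (real (Suc n))"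
    by metis
  have "(\<lambda>n. norm (to_completion (a n) - X n)) \<longlonglongrightarrow> 0"
    by (rule tendsto_sandwich[OF _ _ tendsto_const LIMSEQ_inverse_real_of_nat])
      (use a in \<open>auto simp: dist_norm less_imp_le intro!: always_eventually\<close>)
  then have d: "(\<lambda>n. to_completion (a n) - X n) \<longlonglongrightarrow> 0"
    by (simp add: tendsto_norm_zero_iff)
  then have "Cauchy (\<lambda>n. (to_completion (a n) - X n) + X n)"
    by (rule Cauchy_plus_sequence[OF LIMSEQ_imp_Cauchy X])
  then have "Cauchy a"
    by (simp add: Cauchy_def dist_to_completion)
  from tendsto_diff[OF Cauchy_tendsto_completion[OF this] d]
  show "convergent X" by (auto simp: convergent_def)
qed

section \<open>The binary tree space\<close>

type_synonym binary_tree_space = "c00_tree completion"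

section \<open>The alternative Daugavet property and numerical index 1\<close>

text \<open>\<^const>\<open>dim\<close> is 0 on infinite-dimensional spaces, so the value 1 means exactly
  one-dimensional.\<close>

definition rank_one :: "('a::real_normed_vector \<Rightarrow>\<^sub>L 'b::real_normed_vector) \<Rightarrow> bool" where
  "rank_one R \<longleftrightarrow> dim (range (blinfun_apply R)) = 1"

definition alternative_Daugavet_property :: "'a::banach itself \<Rightarrow> bool" where
  "alternative_Daugavet_property (_ :: 'a itself) \<longleftrightarrow>
    (\<forall>R :: 'a \<Rightarrow>\<^sub>L 'a. rank_one R \<longrightarrow>
      (MAX \<theta>\<in>{-1, 1 :: real}. norm (id_blinfun + \<theta> *\<^sub>R R)) = 1 + norm R)"

text \<open>The set below is bounded above by the norm of \<open>R\<close>, and it is nonempty unless the space is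
  trivial.\<close>

definition has_numerical_index_1 :: "'a::banach itself \<Rightarrow> bool" where
  "has_numerical_index_1 (_ :: 'a itself) \<longleftrightarrow>
    (\<forall>R :: 'a \<Rightarrow>\<^sub>L 'a.
      norm R = Sup {\<bar>blinfun_apply f (blinfun_apply R x)\<bar> | (x :: 'a) (f :: 'a \<Rightarrow>\<^sub>L real).
        norm x = 1 \<and> norm f = 1 \<and> blinfun_apply f x = 1})"

end

theory Submission
  imports Defs
begin

text \<open>
  The reason behind both properties is that the extreme points of the unit ball and of the dual
  unit ball of a finite tree fit together. Let \<open>n\<close> be a height and consider only nodes of length at
  most \<open>n\<close>. The norm is then the largest \<open>\<ell>\<^sub>1\<close>-norm along a branch, so it is normed by the
  functionals \<open>y \<mapsto> \<Sum>t\<preceq>b. \<epsilon>\<^sub>t y(t)\<close> with \<open>b\<close> of length \<open>n\<close> and signs \<open>\<epsilon>\<close>. Dually, every linear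
  functional with coefficients \<open>g\<close> attains its norm at a vector that is \<open>\<plusminus>1\<close> on a \<^emph>\<open>front\<close>, a set
  meeting each branch exactly once, and \<open>0\<close> elsewhere (\<open>front_dominates\<close>). A branch meets a front in
  one node, so a signed branch takes the value \<open>\<plusminus>1\<close> at every signed front.

  Now let \<open>R\<close> be a bounded operator and \<open>a\<close> a finitely supported vector. A signed branch \<open>h\<close> almost
  norms \<open>R a\<close>. The functional \<open>h \<circ> R\<close> is at least as large, relative to the norm, at some signed
  front \<open>v\<close> as at \<open>a\<close>; and \<open>\<bar>h v\<bar> = 1\<close> holds automatically. Hence the numerical radius of \<open>R\<close> bounds
  \<open>\<parallel>R a\<parallel> / \<parallel>a\<parallel>\<close> (\<open>signed_branch_and_front\<close>), and by density it is \<open>\<parallel>R\<parallel>\<close>.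

  Numerical index 1 in turn yields the norm equality for every operator: if \<open>f x = 1\<close> and
  \<open>\<bar>f (R x)\<bar>\<close> is close to \<open>\<parallel>R\<parallel>\<close>, then \<open>f (x + \<theta> R x) = 1 + \<bar>f (R x)\<bar>\<close> for the right sign \<open>\<theta>\<close>.
\<close>

section \<open>Fronts of a finite tree\<close>

definition front :: "nat \<Rightarrow> bool list set \<Rightarrow> bool" where
  "front n V \<longleftrightarrow> V \<subseteq> {t. length t \<le> n} \<and> (\<forall>b. length b = n \<longrightarrow> (\<exists>!t. t \<in> V \<and> prefix t b))"

lemma finite_prefixes: "finite {t. prefix t b}"
  by (metis List.finite_set set_prefixes_eq)

lemma finite_bounded_nodes: "finite {t :: bool list. length t \<le> n}"
  using finite_lists_length_le[of "UNIV :: bool set" n] by simp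

lemma finite_front: "front n V \<Longrightarrow> finite V"
  unfolding front_def using finite_subset[OF _ finite_bounded_nodes] by blast

text \<open>Extend \<open>t\<close> to a branch of length \<open>n\<close>; it passes through both \<open>s\<close> and \<open>t\<close>.\<close>

lemma front_antichain:
  assumes "front n V" "s \<in> V" "t \<in> V" "prefix s t"
  shows "s = t"
proof -
  have "length t \<le> n" using assms by (auto simp: front_def)
  then have "length (t @ replicate (n - length t) True) = n" by simp
  moreover have "prefix t (t @ replicate (n - length t) True)"
    and "prefix s (t @ replicate (n - length t) True)"
    using assms(4) by auto
  ultimately show ?thesis using assms(1-3) unfolding front_def by blast
qed

lemma bounded_nodes_Suc:
  "{t :: bool list. length t \<le> Suc n} = insert []
    ((Cons False ` {t. length t \<le> n}) \<union> (Cons True ` {t. length t \<le> n}))"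
proof (rule set_eqI)
  fix t :: "bool list"
  show "t \<in> {t. length t \<le> Suc n} \<longleftrightarrow>
    t \<in> insert [] ((Cons False ` {t. length t \<le> n}) \<union> (Cons True ` {t. length t \<le> n}))"
  proof (cases t)
    case (Cons c u)
    then show ?thesis by (cases c) auto
  qed simp
qed

lemma sum_Cons_images:
  fixes f :: "bool list \<Rightarrow> real"
  assumes "finite A" "finite B"
  shows "sum f (Cons False ` A \<union> Cons True ` B) = (\<Sum>t\<in>A. f (False # t)) + (\<Sum>t\<in>B. f (True # t))"
  by (subst sum.union_disjoint) (use assms in \<open>auto simp: sum.reindex\<close>)

lemma sum_bounded_nodes_Suc:
  fixes f :: "bool list \<Rightarrow> real"
  shows "(\<Sum>t | length t \<le> Suc n. f t) =
    f [] + ((\<Sum>t | length t \<le> n. f (False # t)) + (\<Sum>t | length t \<le> n. f (True # t)))"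
  unfolding bounded_nodes_Suc
  by (subst sum.insert) (auto simp: sum_Cons_images finite_bounded_nodes)

lemma sum_prefix_Cons:
  fixes f :: "bool list \<Rightarrow> real"
  shows "(\<Sum>t | prefix t (c # b). f t) = f [] + (\<Sum>t | prefix t b. f (c # t))"
proof -
  have "{t. prefix t (c # b)} = insert [] (Cons c ` {t. prefix t b})"
    by (auto simp: prefix_Cons)
  then show ?thesis
    by (simp add: sum.insert[OF finite_imageI[OF finite_prefixes]] sum.reindex image_iff)
qed

lemma front_root: "front n {[]}"
  by (auto simp: front_def)

lemma front_Suc:
  assumes "front n V" "front n W"
  shows "front (Suc n) (Cons False ` V \<union> Cons True ` W)"
  unfolding front_def
proof (intro conjI allI impI)
  show "Cons False ` V \<union> Cons True ` W \<subseteq> {t. length t \<le> Suc n}"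
    using assms by (auto simp: front_def)
next
  fix b :: "bool list"
  assume "length b = Suc n"
  then obtain c u where b: "b = c # u" "length u = n" by (cases b) auto
  have 1: "\<exists>!t. t \<in> V \<and> prefix t u" and 2: "\<exists>!t. t \<in> W \<and> prefix t u"
    using assms b(2) by (auto simp: front_def)
  show "\<exists>!t. t \<in> Cons False ` V \<union> Cons True ` W \<and> prefix t b"
  proof (cases c)
    case True
    then show ?thesis using 2 b by (auto simp: prefix_Cons)
  next
    case False
    then show ?thesis using 1 b by (auto simp: prefix_Cons)
  qed
qed

text \<open>The norm of a functional on a finite tree. At each node the norm of \<open>x\<close> is \<open>\<bar>x []\<bar>\<close> plus the
  maximum over the two subtrees, so the dual norm of the weights \<open>g\<close> is the maximum of \<open>g []\<close> and
  the sum over the two subtrees. Unwinding this recursion selects a front: stop at the current node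
  when its own weight is the larger term, otherwise descend to both sides. The constant \<open>K\<close> stands
  for the norm of \<open>x\<close>; passing to the subtrees lowers it to \<open>K - \<bar>x []\<bar>\<close>.\<close>

lemma front_dominates:
  fixes g :: "bool list \<Rightarrow> real"
  assumes "\<And>t. 0 \<le> g t"
  shows "\<exists>V. front n V \<and> (\<forall>(x :: bool list \<Rightarrow> real) K.
    (\<forall>b. length b = n \<longrightarrow> (\<Sum>t | prefix t b. \<bar>x t\<bar>) \<le> K) \<longrightarrow>
    (\<Sum>t | length t \<le> n. \<bar>x t\<bar> * g t) \<le> K * (\<Sum>t\<in>V. g t))"
  using assms
proof (induction n arbitrary: g)
  case 0
  show ?case
    by (rule exI[of _ "{[]}"]) (auto simp: front_root intro!: mult_right_mono 0)
next
  case (Suc n)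
  obtain V where V: "front n V" and V_dom: "\<And>(x :: bool list \<Rightarrow> real) K.
      (\<And>b. length b = n \<Longrightarrow> (\<Sum>t | prefix t b. \<bar>x t\<bar>) \<le> K) \<Longrightarrow>
      (\<Sum>t | length t \<le> n. \<bar>x t\<bar> * g (False # t)) \<le> K * (\<Sum>t\<in>V. g (False # t))"
    using Suc.IH[of "\<lambda>t. g (False # t)"] Suc.prems by blast
  obtain W where W: "front n W" and W_dom: "\<And>(x :: bool list \<Rightarrow> real) K.
      (\<And>b. length b = n \<Longrightarrow> (\<Sum>t | prefix t b. \<bar>x t\<bar>) \<le> K) \<Longrightarrow>
      (\<Sum>t | length t \<le> n. \<bar>x t\<bar> * g (True # t)) \<le> K * (\<Sum>t\<in>W. g (True # t))"
    using Suc.IH[of "\<lambda>t. g (True # t)"] Suc.prems by blast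
  define p where "p = (\<Sum>t\<in>V. g (False # t)) + (\<Sum>t\<in>W. g (True # t))"
  have bound: "(\<Sum>t | length t \<le> Suc n. \<bar>x t\<bar> * g t) \<le> K * m"
    if K: "\<forall>b. length b = Suc n \<longrightarrow> (\<Sum>t | prefix t b. \<bar>x t\<bar>) \<le> K"
      and m: "g [] \<le> m" "p \<le> m" for x :: "bool list \<Rightarrow> real" and K m
  proof -
    have sub: "(\<Sum>t | prefix t b. \<bar>x (c # t)\<bar>) \<le> K - \<bar>x []\<bar>" if "length b = n" for b c
      using K[rule_format, of "c # b"] that by (simp add: sum_prefix_Cons)
    have "0 \<le> K - \<bar>x []\<bar>"
      using sub[of "replicate n True" True] by (smt (verit) length_replicate sum_nonneg)
    then have "(K - \<bar>x []\<bar>) * p \<le> (K - \<bar>x []\<bar>) * m"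
      using m(2) by (rule mult_left_mono[rotated])
    moreover have "\<bar>x []\<bar> * g [] \<le> \<bar>x []\<bar> * m"
      using m(1) by (intro mult_left_mono) auto
    moreover have "(\<Sum>t | length t \<le> n. \<bar>x (False # t)\<bar> * g (False # t))
        + (\<Sum>t | length t \<le> n. \<bar>x (True # t)\<bar> * g (True # t)) \<le> (K - \<bar>x []\<bar>) * p"
      unfolding p_def distrib_left by (intro add_mono V_dom W_dom sub)
    ultimately show ?thesis
      unfolding sum_bounded_nodes_Suc by (simp add: algebra_simps)
  qed
  show ?case
  proof (cases "p \<le> g []")
    case True
    with bound[where m = "g []"] front_root[of "Suc n"] show ?thesis
      by (intro exI[of _ "{[]}"]) simp
  next
    case False
    with bound[where m = p] front_Suc[OF V W] show ?thesis
      by (intro exI[of _ "Cons False ` V \<union> Cons True ` W"])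
        (simp add: p_def sum_Cons_images finite_front[OF V] finite_front[OF W])
  qed
qed

section \<open>Branches and fronts in the normed space\<close>

lemma branch_tree_chain: "{t. prefix t b} \<in> tree_chains"
  unfolding tree_chains_def by (auto dest: prefix_same_cases)

lemma chain_sum_le_norm: "A \<in> tree_chains \<Longrightarrow> chain_sum A y \<le> norm y"
  unfolding norm_c00_tree_def by (rule cSUP_upper[OF _ chain_sum_bdd_above])

lemma chain_sum_finite_chain:
  assumes "finite A"
  shows "chain_sum A y = (\<Sum>t\<in>A. \<bar>tree_coeff y t\<bar>)"
  unfolding chain_sum_def using assms by (rule infsum_finite)

lemma branch_sum_le_norm: "(\<Sum>t | prefix t b. \<bar>tree_coeff y t\<bar>) \<le> norm y"
  using chain_sum_le_norm[OF branch_tree_chain] by (simp add: chain_sum_finite_chain finite_prefixes)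

lemma finite_chain_subset_branch:
  assumes chain: "\<And>s t. s \<in> A \<Longrightarrow> t \<in> A \<Longrightarrow> prefix s t \<or> prefix t s"
    and len: "\<And>t. t \<in> A \<Longrightarrow> length t \<le> n"
  shows "\<exists>b. length b = n \<and> A \<subseteq> {t :: bool list. prefix t b}"
proof (cases "A = {}")
  case True
  then show ?thesis by (intro exI[of _ "replicate n True"]) simp
next
  case False
  have "finite A" by (rule finite_subset[OF _ finite_bounded_nodes[of n]]) (use len in auto)
  then have "Max (length ` A) \<in> length ` A" using False by simp
  then obtain m where m: "m \<in> A" "length m = Max (length ` A)" by auto
  have longest: "length t \<le> length m" if "t \<in> A" for t
    using that \<open>finite A\<close> by (simp add: m(2))
  have "prefix t m" if "t \<in> A" for t
    using chain[OF that m(1)] longest[OF that] by (auto simp: prefix_def)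
  then have "A \<subseteq> {t. prefix t (m @ replicate (n - length m) True)}" by auto
  moreover have "length (m @ replicate (n - length m) True) = n" using len[OF m(1)] by simp
  ultimately show ?thesis by blast
qed

text \<open>Only the trace of a chain on the support of \<open>y\<close> matters for its sum, and that trace lies on a
  branch. So the chains, which may be infinite, can be replaced by branches of a fixed length.\<close>

lemma branch_almost_norms:
  assumes supp: "\<And>t. tree_coeff y t \<noteq> 0 \<Longrightarrow> length t \<le> n" and e: "0 < e"
  shows "\<exists>b. length b = n \<and> norm y - e < (\<Sum>t | prefix t b. \<bar>tree_coeff y t\<bar>)"
proof -
  have "norm y - e < (SUP A\<in>tree_chains. chain_sum A y)"
    using e by (simp add: norm_c00_tree_def)
  then obtain A where A: "A \<in> tree_chains" "norm y - e < chain_sum A y"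
    using less_cSUP_iff[OF _ chain_sum_bdd_above] singleton_tree_chain by blast
  let ?S = "A \<inter> {t. tree_coeff y t \<noteq> 0}"
  obtain b where b: "length b = n" "?S \<subseteq> {t. prefix t b}"
    using finite_chain_subset_branch[of ?S n] A(1) supp unfolding tree_chains_def by auto
  have "chain_sum A y = (\<Sum>t\<in>?S. \<bar>tree_coeff y t\<bar>)"
    by (rule chain_sum_finite[OF finite_support_tree_coeff order_refl])
  also have "\<dots> \<le> (\<Sum>t | prefix t b. \<bar>tree_coeff y t\<bar>)"
    by (rule sum_mono2[OF finite_prefixes b(2)]) auto
  finally show ?thesis using A(2) b(1) by auto
qed

text \<open>The restriction of \<open>x\<close> to \<open>V\<close>. It is set to \<open>0\<close> for infinite \<open>V\<close> so that the support is
  always finite.\<close>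

lift_definition tree_vec :: "bool list set \<Rightarrow> (bool list \<Rightarrow> real) \<Rightarrow> c00_tree"
  is "\<lambda>V x t. if finite V \<and> t \<in> V then x t else 0"
  by (rule finite_subset[of _ "if finite V then V else {}" for V]) auto

lemma tree_coeff_tree_vec:
  "finite V \<Longrightarrow> tree_coeff (tree_vec V x) t = (if t \<in> V then x t else 0)"
  by (simp add: tree_vec.rep_eq)

lemma tree_coeff_sum: "tree_coeff (sum f S) t = (\<Sum>s\<in>S. tree_coeff (f s) t)"
  by (induction S rule: infinite_finite_induct)
    (simp_all add: zero_c00_tree.rep_eq plus_c00_tree.rep_eq)

lemma tree_expansion:
  assumes "finite F" and "{t. tree_coeff x t \<noteq> 0} \<subseteq> F"
  shows "x = (\<Sum>s\<in>F. tree_coeff x s *\<^sub>R tree_vec {s} (\<lambda>_. 1))"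
  using assms
  by (auto simp: tree_coeff_inject[symmetric] fun_eq_iff tree_coeff_sum scaleR_c00_tree.rep_eq
      tree_coeff_tree_vec if_distrib cong: if_cong)

text \<open>A front is an antichain, so a chain meets it in at most one node.\<close>

lemma norm_signed_front_le:
  assumes V: "front n V" and x: "\<And>t. \<bar>x t\<bar> \<le> 1"
  shows "norm (tree_vec V x) \<le> 1"
  unfolding norm_c00_tree_def
proof (rule cSUP_least)
  show "tree_chains \<noteq> {}" using singleton_tree_chain by blast
next
  fix A
  assume A: "A \<in> tree_chains"
  have "chain_sum A (tree_vec V x) = (\<Sum>t\<in>A \<inter> V. \<bar>tree_coeff (tree_vec V x) t\<bar>)"
    by (rule chain_sum_finite) (use finite_front[OF V] in \<open>auto simp: tree_coeff_tree_vec\<close>)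
  also have "\<dots> \<le> (\<Sum>t\<in>A \<inter> V. 1)"
    by (rule sum_mono) (use x finite_front[OF V] in \<open>auto simp: tree_coeff_tree_vec\<close>)
  also have "\<dots> = card (A \<inter> V)" by simp
  also have "card (A \<inter> V) \<le> 1"
  proof (rule card_le_Suc0_iff_eq[THEN iffD2, simplified One_nat_def[symmetric]])
    show "finite (A \<inter> V)" using finite_front[OF V] by blast
    show "\<forall>s\<in>A \<inter> V. \<forall>t\<in>A \<inter> V. s = t"
      using A front_antichain[OF V] unfolding tree_chains_def by blast
  qed
  finally show "chain_sum A (tree_vec V x) \<le> 1" by simp
qed

lemma bounded_linear_tree_coeff: "bounded_linear (\<lambda>y. tree_coeff y t)"
  by (rule bounded_linear_intro[of _ 1])
    (use chain_sum_le_norm[OF singleton_tree_chain[of t]] in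
      \<open>auto simp: plus_c00_tree.rep_eq scaleR_c00_tree.rep_eq chain_sum_def\<close>)

lift_definition signed_branch :: "bool list \<Rightarrow> (bool list \<Rightarrow> real) \<Rightarrow> c00_tree \<Rightarrow>\<^sub>L real"
  is "\<lambda>b \<epsilon> y. \<Sum>t | prefix t b. \<epsilon> t * tree_coeff y t"
  by (rule bounded_linear_sum, rule bounded_linear_const_mult, rule bounded_linear_tree_coeff)

lemma norm_signed_branch_le:
  assumes "\<And>t. \<bar>\<epsilon> t\<bar> \<le> 1"
  shows "norm (signed_branch b \<epsilon>) \<le> 1"
proof (rule norm_blinfun_bound)
  fix y
  have "norm (signed_branch b \<epsilon> y) \<le> (\<Sum>t | prefix t b. \<bar>\<epsilon> t * tree_coeff y t\<bar>)"
    by (simp add: signed_branch.rep_eq sum_abs)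
  also have "\<dots> \<le> (\<Sum>t | prefix t b. \<bar>tree_coeff y t\<bar>)"
    by (rule sum_mono) (use assms in \<open>auto simp: abs_mult intro!: mult_left_le_one_le\<close>)
  also have "\<dots> \<le> 1 * norm y" using branch_sum_le_norm by simp
  finally show "norm (signed_branch b \<epsilon> y) \<le> 1 * norm y" .
qed simp

text \<open>A branch and a front meet in exactly one node, so the pairing is a single product of signs.\<close>

lemma abs_signed_branch_signed_front:
  assumes V: "front n V" and b: "length b = n"
    and \<epsilon>: "\<And>t. \<bar>\<epsilon> t\<bar> = 1" and x: "\<And>t. \<bar>x t\<bar> = 1"
  shows "\<bar>signed_branch b \<epsilon> (tree_vec V x)\<bar> = 1"
proof -
  obtain u where u: "u \<in> V" "prefix u b" and unique: "\<And>t. t \<in> V \<Longrightarrow> prefix t b \<Longrightarrow> t = u"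
    using V b unfolding front_def by metis
  have "signed_branch b \<epsilon> (tree_vec V x) =
      (\<Sum>t | prefix t b. if t = u then \<epsilon> t * x t else 0)"
    unfolding signed_branch.rep_eq tree_coeff_tree_vec[OF finite_front[OF V]]
  proof (rule sum.cong[OF refl])
    fix t
    assume "t \<in> {t. prefix t b}"
    then have "t \<in> V \<longleftrightarrow> t = u" using u unique by blast
    then show "\<epsilon> t * (if t \<in> V then x t else 0) = (if t = u then \<epsilon> t * x t else 0)"
      by simp
  qed
  also have "\<dots> = \<epsilon> u * x u"
    using u(2) by (simp add: sum.delta[OF finite_prefixes])
  finally show ?thesis by (simp add: abs_mult \<epsilon> x)
qed

text \<open>Signs are taken with value \<open>1\<close> at \<open>0\<close>: every entry of a signed branch or front has to be \<open>\<plusminus>1\<close>,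
  including those where the vector or functional that it is fitted to vanishes.\<close>

definition unit_sign :: "real \<Rightarrow> real" where
  "unit_sign r = (if r < 0 then -1 else 1)"

lemma unit_sign_mult_self: "unit_sign r * r = \<bar>r\<bar>"
  by (simp add: unit_sign_def)

lemma abs_unit_sign: "\<bar>unit_sign r\<bar> = 1"
  by (simp add: unit_sign_def)

section \<open>Bounded operators on a completion\<close>

lift_definition completion_extend ::
  "('a::real_normed_vector \<Rightarrow>\<^sub>L 'b::banach) \<Rightarrow> 'a completion \<Rightarrow> 'b"
  is "\<lambda>L X. lim (\<lambda>n. blinfun_apply L (X n))"
proof -
  fix L :: "'a \<Rightarrow>\<^sub>L 'b" and X Y :: "nat \<Rightarrow> 'a"
  assume XY: "cauchy_rel X Y"
  have "convergent (\<lambda>n. L (X n))"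
    using XY by (auto simp: cauchy_rel_def Cauchy_convergent_iff[symmetric]
        intro: bounded_linear.Cauchy[OF blinfun.bounded_linear_right])
  then have 1: "(\<lambda>n. L (X n)) \<longlonglongrightarrow> lim (\<lambda>n. L (X n))" by (simp add: convergent_LIMSEQ_iff)
  have "(\<lambda>n. L (X n - Y n)) \<longlonglongrightarrow> L 0"
    using XY unfolding cauchy_rel_def by (intro tendsto_intros) auto
  from tendsto_diff[OF 1 this] show "lim (\<lambda>n. L (X n)) = lim (\<lambda>n. L (Y n))"
    by (simp add: blinfun.bilinear_simps limI[symmetric])
qed

lemma tendsto_completion_extend:
  fixes L :: "'a::real_normed_vector \<Rightarrow>\<^sub>L 'b::banach"
  assumes "Cauchy X"
  shows "(\<lambda>n. L (X n)) \<longlonglongrightarrow> completion_extend L (abs_completion X)"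
proof -
  have "cauchy_rel X X" using assms by (simp add: cauchy_rel_def)
  then have "completion_extend L (abs_completion X) = lim (\<lambda>n. L (X n))"
    by (rule completion_extend.abs_eq)
  moreover have "convergent (\<lambda>n. L (X n))"
    using assms by (auto simp: Cauchy_convergent_iff[symmetric]
        intro: bounded_linear.Cauchy[OF blinfun.bounded_linear_right])
  ultimately show ?thesis by (simp add: convergent_LIMSEQ_iff)
qed

lemma completion_extend_to_completion: "completion_extend L (to_completion a) = L a"
  by transfer (simp add: limI)

lemma completion_cases:
  obtains X where "Cauchy X" "x = abs_completion X"
  by (induct x) (auto simp: cauchy_rel_def)

lemma bounded_extension_to_completion:
  fixes L :: "'a::real_normed_vector \<Rightarrow>\<^sub>L 'b::banach"
  shows "\<exists>F :: 'a completion \<Rightarrow>\<^sub>L 'b. norm F \<le> norm L \<and>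
    (\<forall>a. blinfun_apply F (to_completion a) = L a)"
proof -
  let ?E = "completion_extend L"
  have add: "?E (x + y) = ?E x + ?E y" for x y
  proof -
    obtain X Y where X: "Cauchy X" "x = abs_completion X" and Y: "Cauchy Y" "y = abs_completion Y"
      by (metis completion_cases)
    have "(\<lambda>n. L (X n + Y n)) \<longlonglongrightarrow> ?E (x + y)"
      using tendsto_completion_extend[OF Cauchy_plus_sequence[OF X(1) Y(1)], of L] X Y
      by (simp add: plus_completion.abs_eq cauchy_rel_def)
    moreover have "(\<lambda>n. L (X n + Y n)) \<longlonglongrightarrow> ?E x + ?E y"
      unfolding blinfun.add_right X(2) Y(2)
      by (intro tendsto_add tendsto_completion_extend X(1) Y(1))
    ultimately show ?thesis by (rule LIMSEQ_unique)
  qed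
  have scale: "?E (r *\<^sub>R x) = r *\<^sub>R ?E x" for r x
  proof -
    obtain X where X: "Cauchy X" "x = abs_completion X"
      by (metis completion_cases)
    have "(\<lambda>n. L (r *\<^sub>R X n)) \<longlonglongrightarrow> ?E (r *\<^sub>R x)"
      using tendsto_completion_extend[OF Cauchy_scaleR_sequence[OF X(1)], of L r] X
      by (simp add: scaleR_completion.abs_eq cauchy_rel_def)
    moreover have "(\<lambda>n. L (r *\<^sub>R X n)) \<longlonglongrightarrow> r *\<^sub>R ?E x"
      unfolding blinfun.scaleR_right X(2)
      by (intro tendsto_scaleR tendsto_const tendsto_completion_extend X(1))
    ultimately show ?thesis by (rule LIMSEQ_unique)
  qed
  have bound: "norm (?E x) \<le> norm L * norm x" for x
  proof -
    obtain X where X: "Cauchy X" "x = abs_completion X"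
      by (metis completion_cases)
    have "norm x = lim (\<lambda>n. norm (X n))"
      using X by (simp add: norm_completion.abs_eq cauchy_rel_def)
    then have "(\<lambda>n. norm L * norm (X n)) \<longlonglongrightarrow> norm L * norm x"
      using tendsto_lim_norm[OF X(1)] by (simp add: tendsto_mult_left)
    moreover have "(\<lambda>n. norm (L (X n))) \<longlonglongrightarrow> norm (?E x)"
      unfolding X(2) by (intro tendsto_norm tendsto_completion_extend X(1))
    ultimately show ?thesis
      by (intro LIMSEQ_le[where Y = "\<lambda>n. norm L * norm (X n)"]) (auto intro: norm_blinfun)
  qed
  have "bounded_linear ?E"
    by (rule bounded_linear_intro[of _ "norm L"])
      (auto simp: add scale bound mult.commute[of _ "norm L"])
  then have apply_E: "blinfun_apply (Blinfun ?E) = ?E" by (rule bounded_linear_Blinfun_apply)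
  show ?thesis
    by (rule exI[of _ "Blinfun ?E"])
      (auto simp: apply_E completion_extend_to_completion bound intro!: norm_blinfun_bound)
qed

lemma norm_le_on_completion:
  fixes R :: "'a::real_normed_vector completion \<Rightarrow>\<^sub>L 'b::real_normed_vector"
  assumes "0 \<le> B" "\<And>a. norm (R (to_completion a)) \<le> B * norm a"
  shows "norm R \<le> B"
proof (rule norm_blinfun_bound[OF assms(1)])
  fix x
  have "closed {x. norm (R x) \<le> B * norm x}"
    by (intro closed_Collect_le continuous_intros)
  then have "closure (range to_completion) \<subseteq> {x. norm (R x) \<le> B * norm x}"
    by (rule closure_minimal[rotated]) (use assms(2) in \<open>auto simp: norm_to_completion\<close>)
  then show "norm (R x) \<le> B * norm x"
    unfolding closure_range_to_completion by auto
qed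

section \<open>Numerical index 1\<close>

text \<open>The branch is chosen to norm a finitely supported approximation of \<open>R a\<close>, and \<open>n\<close> is so large
  that the supports of \<open>a\<close> and of this approximation lie below height \<open>n\<close>. Then \<open>h (R a)\<close> depends
  only on the finitely many numbers \<open>c\<^sub>t = h (R e\<^sub>t)\<close>, where \<open>e\<^sub>t\<close> is the unit vector at \<open>t\<close>, and a
  front that dominates the weights \<open>\<bar>c\<^sub>t\<bar>\<close>, signed like \<open>c\<close>, gives the vector.\<close>

lemma signed_branch_and_front:
  fixes R :: "binary_tree_space \<Rightarrow>\<^sub>L binary_tree_space"
  assumes e: "0 < e"
  shows "\<exists>(x :: binary_tree_space) (f :: binary_tree_space \<Rightarrow>\<^sub>L real).
    norm x = 1 \<and> norm f = 1 \<and> blinfun_apply f x = 1 \<and>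
    norm (R (to_completion a)) \<le> norm a * \<bar>blinfun_apply f (R x)\<bar> + e"
proof -
  let ?Ra = "R (to_completion a)"
  obtain y where y: "dist (to_completion y) ?Ra < e / 3"
    using to_completion_approx[of "e / 3" ?Ra] e by auto
  let ?S = "{t. tree_coeff a t \<noteq> 0} \<union> {t. tree_coeff y t \<noteq> 0}"
  define n where "n = Max (insert 0 (length ` ?S))"
  have n: "length t \<le> n" if "t \<in> ?S" for t
    using that unfolding n_def by (intro Max_ge) (auto simp: finite_support_tree_coeff)
  obtain b where b: "length b = n"
    and b_norms: "norm y - e / 3 < (\<Sum>t | prefix t b. \<bar>tree_coeff y t\<bar>)"
    using branch_almost_norms[of y n "e / 3"] n e by auto
  let ?L = "signed_branch b (\<lambda>t. unit_sign (tree_coeff y t))"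
  have L_y: "norm y - e / 3 < ?L y"
    using b_norms by (simp add: signed_branch.rep_eq unit_sign_mult_self)
  obtain h :: "binary_tree_space \<Rightarrow>\<^sub>L real"
    where h: "norm h \<le> norm ?L" and h_ext: "\<And>z. blinfun_apply h (to_completion z) = ?L z"
    using bounded_extension_to_completion[of ?L] by blast
  have h1: "norm h \<le> 1"
    using h norm_signed_branch_le[of "\<lambda>t. unit_sign (tree_coeff y t)" b]
    by (simp add: abs_unit_sign)
  define c where "c t = h (R (to_completion (tree_vec {t} (\<lambda>_. 1))))" for t
  have h_R: "h (R (to_completion z)) = (\<Sum>t\<in>F. tree_coeff z t * c t)"
    if F: "finite F" "{t. tree_coeff z t \<noteq> 0} \<subseteq> F" for z F
    by (subst tree_expansion[OF F])
      (simp add: c_def linear_sum[OF linear_to_completion] linear_scale[OF linear_to_completion]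
        blinfun.sum_right blinfun.scaleR_right)
  obtain V where V: "front n V" and V_dom: "\<And>(x :: bool list \<Rightarrow> real) K.
      (\<And>b. length b = n \<Longrightarrow> (\<Sum>t | prefix t b. \<bar>x t\<bar>) \<le> K) \<Longrightarrow>
      (\<Sum>t | length t \<le> n. \<bar>x t\<bar> * \<bar>c t\<bar>) \<le> K * (\<Sum>t\<in>V. \<bar>c t\<bar>)"
    using front_dominates[of "\<lambda>t. \<bar>c t\<bar>" n] by auto
  define v where "v = tree_vec V (\<lambda>t. unit_sign (c t))"
  let ?v = "to_completion v"
  have v1: "norm ?v \<le> 1"
    unfolding norm_to_completion v_def
    by (rule norm_signed_front_le[OF V]) (simp add: abs_unit_sign)
  have hv: "\<bar>h ?v\<bar> = 1"
    unfolding h_ext v_def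
    by (rule abs_signed_branch_signed_front[OF V b]) (simp_all add: abs_unit_sign)
  have h_R_v: "h (R ?v) = (\<Sum>t\<in>V. \<bar>c t\<bar>)"
    by (subst h_R[OF finite_front[OF V]])
      (auto simp: v_def tree_coeff_tree_vec finite_front[OF V] unit_sign_mult_self)
  have "h ?Ra \<le> (\<Sum>t | length t \<le> n. \<bar>tree_coeff a t\<bar> * \<bar>c t\<bar>)"
    by (subst h_R[OF finite_bounded_nodes[of n]])
      (use n in \<open>auto intro!: sum_mono simp: abs_mult[symmetric]\<close>)
  also have "\<dots> \<le> norm a * h (R ?v)"
    unfolding h_R_v by (rule V_dom) (rule branch_sum_le_norm)
  finally have h_Ra: "h ?Ra \<le> norm a * h (R ?v)" .
  have "norm ?Ra \<le> norm y + e / 3"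
    using norm_triangle_ineq2[of ?Ra "to_completion y"] y
    by (simp add: dist_norm norm_minus_commute norm_to_completion)
  moreover have "?L y - h ?Ra \<le> e / 3"
  proof -
    have "?L y - h ?Ra = h (to_completion y - ?Ra)"
      by (simp add: h_ext blinfun.diff_right)
    also have "\<dots> \<le> norm h * norm (to_completion y - ?Ra)"
      using norm_blinfun[of h "to_completion y - ?Ra"] by simp
    also have "\<dots> \<le> 1 * norm (to_completion y - ?Ra)"
      by (rule mult_right_mono[OF h1]) simp
    finally show ?thesis using y by (simp add: dist_norm)
  qed
  ultimately have main: "norm ?Ra \<le> norm a * h (R ?v) + e"
    using L_y h_Ra by linarith
  \<comment> \<open>Two factors that are at most \<open>1\<close> and have a product at least \<open>1\<close> are both equal to \<open>1\<close>.\<close>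
  have "1 \<le> norm h * norm ?v" using norm_blinfun[of h ?v] hv by simp
  then have norms: "norm h = 1" "norm ?v = 1"
    using h1 v1 mult_left_le[OF v1, of "norm h"] mult_left_le_one_le[of "norm ?v" "norm h"]
    by auto
  \<comment> \<open>The factor \<open>h ?v = \<plusminus>1\<close> turns \<open>\<bar>h ?v\<bar> = 1\<close> into \<open>f ?v = 1\<close>.\<close>
  define f where "f = h ?v *\<^sub>R h"
  have "norm f = 1" "f ?v = 1"
    using norms(1) hv abs_mult_self_eq[of "h ?v"]
    by (simp_all add: f_def blinfun.scaleR_left)
  moreover have "norm ?Ra \<le> norm a * \<bar>f (R ?v)\<bar> + e"
  proof -
    have "h (R ?v) \<le> \<bar>f (R ?v)\<bar>" using hv by (simp add: f_def blinfun.scaleR_left abs_mult)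
    then show ?thesis using main mult_left_mono[of "h (R ?v)" "\<bar>f (R ?v)\<bar>" "norm a"] by simp
  qed
  ultimately show ?thesis using norms(2) by blast
qed

theorem numerical_index_1_binary_tree_space: "has_numerical_index_1 TYPE(binary_tree_space)"
  unfolding has_numerical_index_1_def
proof
  fix R :: "binary_tree_space \<Rightarrow>\<^sub>L binary_tree_space"
  let ?N = "{\<bar>blinfun_apply f (R x)\<bar> | (x :: binary_tree_space) (f :: binary_tree_space \<Rightarrow>\<^sub>L real).
    norm x = 1 \<and> norm f = 1 \<and> blinfun_apply f x = 1}"
  have ne: "?N \<noteq> {}" using signed_branch_and_front[of 1 R 0] by auto
  show "norm R = Sup ?N"
  proof (rule cSup_eq_non_empty[OF ne, symmetric])
    fix r
    assume "r \<in> ?N"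
    then obtain x f where r: "r = \<bar>blinfun_apply f (R x)\<bar>" "norm x = 1" "norm f = 1" by blast
    then show "r \<le> norm R"
      using norm_blinfun[of f "R x"] norm_blinfun[of R x] by simp
  next
    fix B
    assume B: "\<And>r. r \<in> ?N \<Longrightarrow> r \<le> B"
    have "0 \<le> B" using ne B by force
    show "norm R \<le> B"
    proof (rule norm_le_on_completion[OF \<open>0 \<le> B\<close>], rule field_le_epsilon)
      fix a :: c00_tree and e :: real
      assume "0 < e"
      then obtain x and f :: "binary_tree_space \<Rightarrow>\<^sub>L real"
        where xf: "norm x = 1" "norm f = 1" "blinfun_apply f x = 1"
          and le: "norm (R (to_completion a)) \<le> norm a * \<bar>blinfun_apply f (R x)\<bar> + e"
        using signed_branch_and_front by blast
      have "\<bar>f (R x)\<bar> \<le> B" using B xf by blast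
      then have "norm a * \<bar>f (R x)\<bar> \<le> B * norm a"
        by (subst mult.commute[of B]) (rule mult_left_mono, simp_all)
      with le show "norm (R (to_completion a)) \<le> B * norm a + e" by simp
    qed
  qed
qed

section \<open>The alternative Daugavet property\<close>

lemma numerical_index_1_imp_norm_equality:
  fixes R :: "'a::banach \<Rightarrow>\<^sub>L 'a"
  assumes index: "has_numerical_index_1 TYPE('a)"
    and ne: "\<exists>(x :: 'a) (f :: 'a \<Rightarrow>\<^sub>L real). norm x = 1 \<and> norm f = 1 \<and> blinfun_apply f x = 1"
  shows "(MAX \<theta>\<in>{-1, 1 :: real}. norm (id_blinfun + \<theta> *\<^sub>R R)) = 1 + norm R" (is "?M = _")
proof (rule antisym)
  have "norm (id_blinfun + \<theta> *\<^sub>R R) \<le> 1 + norm R" if "\<bar>\<theta>\<bar> = 1" for \<theta>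
    using norm_triangle_ineq[of "id_blinfun :: 'a \<Rightarrow>\<^sub>L 'a" "\<theta> *\<^sub>R R"]
      norm_blinfun_bound[of 1 "id_blinfun :: 'a \<Rightarrow>\<^sub>L 'a"] that by simp
  from this[of 1] this[of "-1"] show "?M \<le> 1 + norm R" by simp
next
  let ?N = "{\<bar>blinfun_apply f (R x)\<bar> | (x :: 'a) (f :: 'a \<Rightarrow>\<^sub>L real).
    norm x = 1 \<and> norm f = 1 \<and> blinfun_apply f x = 1}"
  have "norm R = Sup ?N" using index by (simp add: has_numerical_index_1_def)
  also have "Sup ?N \<le> ?M - 1"
  proof (rule cSup_least)
    show "?N \<noteq> {}" using ne by blast
    fix r
    assume "r \<in> ?N"
    then obtain x and f :: "'a \<Rightarrow>\<^sub>L real"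
      where r: "r = \<bar>blinfun_apply f (R x)\<bar>"
        and xf: "norm x = 1" "norm f = 1" "blinfun_apply f x = 1" by blast
    let ?\<theta> = "unit_sign (f (R x))"
    let ?T = "id_blinfun + ?\<theta> *\<^sub>R R"
    have "f (?T x) = 1 + ?\<theta> * f (R x)"
      using xf by (simp add: blinfun.bilinear_simps)
    also have "\<dots> = 1 + r" unfolding r unit_sign_mult_self ..
    finally have "1 + r \<le> norm (f (?T x))" by simp
    also have "\<dots> \<le> norm (?T x)" using norm_blinfun[of f "?T x"] xf by simp
    also have "\<dots> \<le> norm ?T" using norm_blinfun[of ?T x] xf by simp
    also have "\<dots> \<le> ?M" by (rule Max_ge) (auto simp: unit_sign_def)
    finally show "r \<le> ?M - 1" by simp
  qed
  finally show "1 + norm R \<le> ?M" by simp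
qed

theorem theorem3p5:
  shows "alternative_Daugavet_property TYPE(binary_tree_space) \<and>
    has_numerical_index_1 TYPE(binary_tree_space)"
proof
  \<comment> \<open>Any operator serves here, only the pair \<open>x\<close>, \<open>f\<close> is wanted.\<close>
  have "\<exists>(x :: binary_tree_space) (f :: binary_tree_space \<Rightarrow>\<^sub>L real).
      norm x = 1 \<and> norm f = 1 \<and> blinfun_apply f x = 1"
    using signed_branch_and_front[of 1 0 0, OF zero_less_one] by blast
  then show "alternative_Daugavet_property TYPE(binary_tree_space)"
    unfolding alternative_Daugavet_property_def
    using numerical_index_1_imp_norm_equality[OF numerical_index_1_binary_tree_space] by blast
qed (rule numerical_index_1_binary_tree_space)

end
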